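(* Let $\{W_j\}_{j\in J}$ be a family of closed subspaces of $\mathcal{H}$ and for each $j\in J$ let $\{e_{ij}\}_{i\in I_j}$ be an orthonormal basis for $W_j$. Then the following conditions are equivalent: (i) $\{W_j\}_{j\in J}$ is a Riesz $f$-basis for $\mathcal{H}$. (ii) $\{e_{ij}\}_{j\in J,\,i\in I_j}$ is a Riesz basis for $\mathcal{H}$.
   Context: $\mathcal{H}$ is a separable Hilbert space, $J$ and $I_j$ are countable (or finite) index sets, and $\pi_W$ denotes the orthogonal projection onto a closed subspace $W$. A sequence $\{V_j\}_{j\in J}$ of closed subspaces of $\mathcal{H}$ is an orthonormal $f$-basis for $\mathcal{H}$ if $\pi_{V_i}g_j=\delta_{ij}g_j$ for all $i,j\in J$, $g_j\in V_j$, and $\mathcal{H}=\overline{\operatorname{span}}\{V_j\}_{j\in J}$. $\{W_j\}_{j\in J}$ is a Riesz $f$-basis (Riesz fusion basis) for $\mathcal{H}$ if there exist an orthonormal $f$-basis $\{V_j\}_{j\in J}$ for $\mathcal{H}$ and a bounded invertible linear operator $T$ on $\mathcal{H}$ such that $TV_j=W_j$ for all $j\in J$. *)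

theory Defs
  imports
    "HOL-Analysis.Analysis"
    "Jordan_Normal_Form.Conjugate"
begin

text \<open>
  The scalar field is left open between the real and the complex numbers. Up to isomorphism these
  are the only instances of the following class: by the lemmas below, every scalar fixed by
  conjugation is real, so that every scalar \<open>x\<close> is a root of the real quadratic polynomial
  \<open>(X - x) (X - conjugate x)\<close>.
\<close>

class rc_field = real_normed_field + conjugatable_field +
  assumes mult_conjugate: "x * conjugate x = (norm x)\<^sup>2 *\<^sub>R 1"

instance real :: rc_field
  by standard (simp add: power2_eq_square)

instance complex :: rc_field
  by standard (simp add: complex_norm_square scaleR_conv_of_real del: of_real_power)

lemma conjugate_fixed_in_Reals:
  fixes x :: "'k::rc_field"
  assumes "conjugate x = x"
  shows "x \<in> \<real>"
proof -
  have "x\<^sup>2 = (of_real (norm x))\<^sup>2"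
    using mult_conjugate[of x] assms by (simp add: power2_eq_square scaleR_conv_of_real)
  then have "x = of_real (norm x) \<or> x = - of_real (norm x)"
    by (simp only: power2_eq_iff)
  then show ?thesis
    by (metis Reals_minus Reals_of_real)
qed

lemma add_conjugate_in_Reals: "x + conjugate x \<in> \<real>" for x :: "'k::rc_field"
  by (rule conjugate_fixed_in_Reals) (simp add: conjugate_dist_add add.commute)

text \<open>
  The norm, the topology and the completeness come from the type class \<open>banach\<close>; the axioms
  say that this norm is the one induced by the inner product \<open>ip\<close> (linear in the first argument)
  and that \<open>scale\<close> extends the real scaling. Within the locale \<open>span\<close> and \<open>subspace\<close> are taken
  with respect to \<open>scale\<close>.
\<close>

locale hilbert_space = vector_space scale
  for scale :: "'k::rc_field \<Rightarrow> 'a::banach \<Rightarrow> 'a" +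
  fixes ip :: "'a \<Rightarrow> 'a \<Rightarrow> 'k"
  assumes scale_of_real: "scale (of_real r) x = r *\<^sub>R x"
    and ip_add_left: "ip (x + y) z = ip x z + ip y z"
    and ip_scale_left: "ip (scale c x) y = c * ip x y"
    and ip_commute: "ip y x = conjugate (ip x y)"
    and ip_self: "ip x x = of_real ((norm x)\<^sup>2)"
begin

definition closed_subspace :: "'a set \<Rightarrow> bool" where
  "closed_subspace W \<longleftrightarrow> subspace W \<and> closed W"

text \<open>Well-defined on closed subspaces only.\<close>
definition proj :: "'a set \<Rightarrow> 'a \<Rightarrow> 'a" where
  "proj W x = (THE p. p \<in> W \<and> (\<forall>w\<in>W. ip (x - p) w = 0))"

definition bounded_operator :: "('a \<Rightarrow> 'a) \<Rightarrow> bool" where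
  "bounded_operator T \<longleftrightarrow>
     Vector_Spaces.linear scale scale T \<and> (\<exists>B. \<forall>x. norm (T x) \<le> B * norm x)"

definition bounded_invertible_operator :: "('a \<Rightarrow> 'a) \<Rightarrow> bool" where
  "bounded_invertible_operator T \<longleftrightarrow>
     bounded_operator T \<and> (\<exists>S. bounded_operator S \<and> S \<circ> T = id \<and> T \<circ> S = id)"

definition orthonormal_basis :: "'b set \<Rightarrow> ('b \<Rightarrow> 'a) \<Rightarrow> 'a set \<Rightarrow> bool" where
  "orthonormal_basis A e W \<longleftrightarrow>
     (\<forall>a\<in>A. \<forall>b\<in>A. ip (e a) (e b) = (if a = b then 1 else 0)) \<and> closure (span (e ` A)) = W"

definition riesz_basis :: "'b set \<Rightarrow> ('b \<Rightarrow> 'a) \<Rightarrow> bool" where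
  "riesz_basis A f \<longleftrightarrow>
     (\<exists>u T. orthonormal_basis A u UNIV \<and> bounded_invertible_operator T \<and> (\<forall>a\<in>A. T (u a) = f a))"

definition orthonormal_fbasis :: "'j set \<Rightarrow> ('j \<Rightarrow> 'a set) \<Rightarrow> bool" where
  "orthonormal_fbasis J V \<longleftrightarrow>
     (\<forall>j\<in>J. closed_subspace (V j)) \<and>
     (\<forall>i\<in>J. \<forall>j\<in>J. \<forall>g\<in>V j. proj (V i) g = (if i = j then g else 0)) \<and>
     closure (span (\<Union>j\<in>J. V j)) = UNIV"

definition riesz_fbasis :: "'j set \<Rightarrow> ('j \<Rightarrow> 'a set) \<Rightarrow> bool" where
  "riesz_fbasis J W \<longleftrightarrow>
     (\<exists>V T. orthonormal_fbasis J V \<and> bounded_invertible_operator T \<and> (\<forall>j\<in>J. T ` V j = W j))"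

end

locale separable_hilbert_space = hilbert_space scale ip
  for scale :: "'k::rc_field \<Rightarrow> 'a::banach \<Rightarrow> 'a" and ip :: "'a \<Rightarrow> 'a \<Rightarrow> 'k" +
  assumes separable: "separable_space (euclidean :: 'a topology)"

lemma hilbert_space_real_inner:
  "hilbert_space (scaleR :: real \<Rightarrow> 'a::{real_inner, banach} \<Rightarrow> 'a) inner"
  by unfold_locales
    (simp_all add: scaleR_add_right scaleR_add_left inner_add_left inner_add_right inner_commute
      power2_norm_eq_inner)

lemma hilbert_space_complex: "hilbert_space ((*) :: complex \<Rightarrow> complex \<Rightarrow> complex) (\<lambda>x y. x * cnj y)"
  by unfold_locales
    (simp_all add: algebra_simps scaleR_conv_of_real complex_norm_square del: of_real_power)

end

theory Submission
  imports Defs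
begin

text \<open>
  If \<open>W\<close> is the image of an orthonormal \<open>f\<close>-basis under a bounded invertible operator, then
  Pythagoras' theorem makes the square norm of a finite sum \<open>\<Sum>\<^sub>j w\<^sub>j\<close> with \<open>w\<^sub>j \<in> W\<^sub>j\<close> comparable
  to \<open>\<Sum>\<^sub>j \<parallel>w\<^sub>j\<parallel>\<^sup>2\<close>. Expanding every \<open>w\<^sub>j\<close> in the orthonormal basis of \<open>W\<^sub>j\<close> shows that the square
  norm of a finite combination of the \<open>e\<^sub>i\<^sub>j\<close> is comparable to the sum of the squares of its
  coefficients. Gram-Schmidt then provides an orthonormal basis over the same index set, and
  matching it with the family \<open>e\<^sub>i\<^sub>j\<close> extends to a bounded operator in both directions.
  Conversely, if \<open>T\<close> maps an orthonormal basis \<open>u\<close> to \<open>e\<close>, then the closed spans of the blocks of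
  \<open>u\<close> form an orthonormal \<open>f\<close>-basis which \<open>T\<close> maps to \<open>W\<close>.
\<close>

section \<open>Finite linear combinations of an indexed family\<close>

context vector_space
begin

text \<open>The sum runs over indices and not over vectors, so \<open>f\<close> may repeat values
  and coefficients stay attached to indices. Being proved for every vector space, it also applies to
  the product space in which operator graphs live.\<close>

lemma span_image_finite_sums:
  assumes "x \<in> span (f ` A)"
  obtains F c where "finite F" "F \<subseteq> A" "x = (\<Sum>a\<in>F. scale (c a) (f a))"
proof -
  from assms have "\<exists>F c. finite F \<and> F \<subseteq> A \<and> x = (\<Sum>a\<in>F. scale (c a) (f a))"
  proof (induction rule: span_induct_alt)
    case base
    then show ?case by (auto intro: exI[of _ "{}"])
  next
    case (step r v y)
    then obtain a F c where *: "a \<in> A" "v = f a" "finite F" "F \<subseteq> A" "y = (\<Sum>a\<in>F. scale (c a) (f a))"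
      by auto
    \<comment> \<open>If \<open>a\<close> is already in \<open>F\<close>, its old coefficient has to
      be increased by \<open>r\<close>; outside \<open>F\<close> the values of \<open>c\<close> are
      arbitrary and are replaced by 0.\<close>
    let ?c = "\<lambda>b. (if b = a then r else 0) + (if b \<in> F then c b else 0)"
    have "(\<Sum>b\<in>insert a F. scale (?c b) (f b))
        = (\<Sum>b\<in>insert a F. if b = a then scale r (f b) else 0)
          + (\<Sum>b\<in>insert a F. if b \<in> F then scale (c b) (f b) else 0)"
      unfolding sum.distrib[symmetric] by (intro sum.cong) (auto simp: scale_left_distrib)
    also have "(\<Sum>b\<in>insert a F. if b = a then scale r (f b) else 0) = scale r v"
      using * by simp
    also have "(\<Sum>b\<in>insert a F. if b \<in> F then scale (c b) (f b) else 0) = y"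
      unfolding *(5) using *(3) by (intro sum.mono_neutral_cong_right) auto
    finally have "finite (insert a F) \<and> insert a F \<subseteq> A
        \<and> scale r v + y = (\<Sum>b\<in>insert a F. scale (?c b) (f b))"
      using * by simp
    then show ?case by (intro exI)
  qed
  then show ?thesis using that by blast
qed

end

section \<open>Inner product algebra, Pythagoras and Cauchy-Schwarz\<close>

context hilbert_space
begin

lemma ip_zero_left [simp]: "ip 0 y = 0"
  using ip_add_left[of 0 0 y] by simp

lemma ip_zero_commute: "ip x y = 0 \<longleftrightarrow> ip y x = 0"
  by (metis conjugate_zero ip_commute)

lemma ip_zero_right [simp]: "ip x 0 = 0"
  by (simp add: ip_zero_commute[of x 0])

lemma ip_add_right: "ip x (y + z) = ip x y + ip x z"
  by (metis conjugate_dist_add ip_add_left ip_commute)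

lemma ip_scale_right: "ip x (scale c y) = conjugate c * ip x y"
  by (metis conjugate_dist_mul ip_scale_left ip_commute)

lemma ip_minus_left: "ip (- x) y = - ip x y"
  using ip_add_left[of x "- x" y] by (simp add: eq_neg_iff_add_eq_0 add.commute)

lemma ip_minus_right: "ip x (- y) = - ip x y"
  using ip_add_right[of x y "- y"] by (simp add: eq_neg_iff_add_eq_0 add.commute)

lemma ip_diff_left: "ip (x - y) z = ip x z - ip y z"
  using ip_add_left[of x "- y" z] by (simp add: ip_minus_left)

lemma ip_diff_right: "ip x (y - z) = ip x y - ip x z"
  using ip_add_right[of x y "- z"] by (simp add: ip_minus_right)

lemma ip_sum_left: "ip (sum f F) y = (\<Sum>a\<in>F. ip (f a) y)"
  by (induction F rule: infinite_finite_induct) (simp_all add: ip_add_left)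

text \<open>A priori the norm is homogeneous for real scalars only; general scalars go through
  \<open>ip_self\<close> and \<open>mult_conjugate\<close>.\<close>

lemma norm_scale: "norm (scale c x) = norm c * norm x"
proof -
  have "(of_real ((norm (scale c x))\<^sup>2) :: 'k) = (c * conjugate c) * ip x x"
    by (simp only: ip_self[symmetric] ip_scale_left ip_scale_right mult_ac)
  also have "\<dots> = of_real ((norm c * norm x)\<^sup>2)"
    by (simp only: mult_conjugate ip_self scaleR_conv_of_real power_mult_distrib of_real_mult mult_1_right)
  finally have "(norm (scale c x))\<^sup>2 = (norm c * norm x)\<^sup>2"
    by (simp only: of_real_eq_iff)
  then show ?thesis
    by (simp add: power2_eq_iff_nonneg)
qed

lemma norm_add_orthogonal:
  assumes "ip x y = 0"
  shows "(norm (x + y))\<^sup>2 = (norm x)\<^sup>2 + (norm y)\<^sup>2"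
proof -
  have "(of_real ((norm (x + y))\<^sup>2) :: 'k) = of_real ((norm x)\<^sup>2 + (norm y)\<^sup>2)"
    using assms ip_zero_commute[of x y]
    by (simp only: ip_self[symmetric] ip_add_left ip_add_right of_real_add) simp
  then show ?thesis
    by (simp only: of_real_eq_iff)
qed

lemma parallelogram:
  fixes x y :: 'a
  shows "(norm (x + y))\<^sup>2 + (norm (x - y))\<^sup>2 = 2 * (norm x)\<^sup>2 + 2 * (norm y)\<^sup>2"
proof -
  have "(of_real ((norm (x + y))\<^sup>2 + (norm (x - y))\<^sup>2) :: 'k)
      = ip (x + y) (x + y) + ip (x - y) (x - y)"
    by (simp only: of_real_add ip_self)
  also have "\<dots> = ip x x + ip x x + (ip y y + ip y y)"
    by (simp add: ip_add_left ip_add_right ip_diff_left ip_diff_right)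
  also have "\<dots> = of_real ((norm x)\<^sup>2 + (norm x)\<^sup>2 + ((norm y)\<^sup>2 + (norm y)\<^sup>2))"
    by (simp only: of_real_add ip_self)
  finally have "(norm (x + y))\<^sup>2 + (norm (x - y))\<^sup>2
      = (norm x)\<^sup>2 + (norm x)\<^sup>2 + ((norm y)\<^sup>2 + (norm y)\<^sup>2)"
    by (simp only: of_real_eq_iff)
  then show ?thesis by simp
qed

lemma norm_sum_orthogonal:
  assumes "finite F" and "\<And>a b. a \<in> F \<Longrightarrow> b \<in> F \<Longrightarrow> a \<noteq> b \<Longrightarrow> ip (v a) (v b) = 0"
  shows "(norm (sum v F))\<^sup>2 = (\<Sum>a\<in>F. (norm (v a))\<^sup>2)"
  using assms
proof (induction F rule: finite_induct)
  case (insert a F)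
  have "ip (sum v F) (v a) = 0"
    unfolding ip_sum_left using insert by (intro sum.neutral) auto
  then have "ip (v a) (sum v F) = 0"
    by (simp add: ip_zero_commute)
  then show ?case
    using insert by (simp add: norm_add_orthogonal)
qed simp

lemma norm_sum_orthonormal:
  assumes "finite F" and "\<And>a b. a \<in> F \<Longrightarrow> b \<in> F \<Longrightarrow> ip (u a) (u b) = (if a = b then 1 else 0)"
  shows "(norm (\<Sum>a\<in>F. scale (c a) (u a)))\<^sup>2 = (\<Sum>a\<in>F. (norm (c a))\<^sup>2)"
proof -
  have "norm (u a) = 1" if "a \<in> F" for a
  proof -
    have "(of_real ((norm (u a))\<^sup>2) :: 'k) = of_real 1"
      using assms(2)[OF that that] ip_self[of "u a"] by simp
    then have "(norm (u a))\<^sup>2 = 1"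
      by (simp only: of_real_eq_iff)
    then show ?thesis
      by (metis abs_1 abs_norm_cancel power2_eq_1_iff abs_minus_cancel)
  qed
  moreover have "(norm (\<Sum>a\<in>F. scale (c a) (u a)))\<^sup>2 = (\<Sum>a\<in>F. (norm (scale (c a) (u a)))\<^sup>2)"
    using assms by (intro norm_sum_orthogonal) (auto simp: ip_scale_left ip_scale_right)
  ultimately show ?thesis
    by (simp add: norm_scale)
qed

text \<open>Here \<open>z\<close> is \<open>x\<close> minus its component along \<open>y\<close>.
  Dropping the norm of \<open>z\<close> from the Pythagorean identity gives Cauchy-Schwarz; the same
  identity later shows that a nearest point leaves an orthogonal residual, and the orthogonality
  drives Gram-Schmidt.\<close>

lemma norm_diff_component:
  fixes x y
  assumes "y \<noteq> 0"
  defines "z \<equiv> x - scale (ip x y / ip y y) y"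
  shows "ip z y = 0" and "(norm x)\<^sup>2 = (norm z)\<^sup>2 + (norm (ip x y) / norm y)\<^sup>2"
proof -
  have "ip y y \<noteq> 0"
    using assms(1) by (simp add: ip_self)
  then show z: "ip z y = 0"
    by (simp add: z_def ip_diff_left ip_scale_left)
  have "(norm x)\<^sup>2 = (norm (z + scale (ip x y / ip y y) y))\<^sup>2"
    by (simp add: z_def)
  also have "\<dots> = (norm z)\<^sup>2 + (norm (scale (ip x y / ip y y) y))\<^sup>2"
    using z by (intro norm_add_orthogonal) (simp add: ip_scale_right)
  also have "norm (scale (ip x y / ip y y) y) = norm (ip x y) / norm y"
    using assms(1) by (simp add: norm_scale norm_divide ip_self power2_eq_square norm_mult)
  finally show "(norm x)\<^sup>2 = (norm z)\<^sup>2 + (norm (ip x y) / norm y)\<^sup>2" .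
qed

lemma norm_ip_le: "norm (ip x y) \<le> norm x * norm y"
proof (cases "y = 0")
  case False
  then have "(norm (ip x y) / norm y)\<^sup>2 \<le> (norm x)\<^sup>2"
    using norm_diff_component(2)[of y x] by simp
  then have "norm (ip x y) / norm y \<le> norm x"
    by (rule power2_le_imp_le) simp
  then show ?thesis
    using False by (simp add: divide_le_eq)
qed simp

section \<open>Continuity and closed spans\<close>

lemma tendsto_ip_left:
  assumes "(X \<longlongrightarrow> x) F"
  shows "((\<lambda>n. ip (X n) y) \<longlongrightarrow> ip x y) F"
proof -
  have "((\<lambda>n. ip (X n) y - ip x y) \<longlongrightarrow> 0) F"
  proof (rule Lim_null_comparison)
    show "\<forall>\<^sub>F n in F. norm (ip (X n) y - ip x y) \<le> norm (X n - x) * norm y"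
      by (simp add: ip_diff_left[symmetric] norm_ip_le)
    have "((\<lambda>n. norm (X n - x) * norm y) \<longlongrightarrow> norm (x - x) * norm y) F"
      by (intro tendsto_intros assms)
    then show "((\<lambda>n. norm (X n - x) * norm y) \<longlongrightarrow> 0) F"
      by simp
  qed
  then show ?thesis
    by (simp add: LIM_zero_iff)
qed

lemma tendsto_scale:
  assumes "(X \<longlongrightarrow> x) F"
  shows "((\<lambda>n. scale c (X n)) \<longlongrightarrow> scale c x) F"
proof -
  have "((\<lambda>n. scale c (X n) - scale c x) \<longlongrightarrow> 0) F"
  proof (rule tendsto_norm_zero_cancel)
    have "((\<lambda>n. norm c * norm (X n - x)) \<longlongrightarrow> norm c * norm (x - x)) F"
      by (intro tendsto_intros assms)
    then show "((\<lambda>n. norm (scale c (X n) - scale c x)) \<longlongrightarrow> 0) F"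
      by (simp add: scale_right_diff_distrib[symmetric] norm_scale)
  qed
  then show ?thesis
    by (simp add: LIM_zero_iff)
qed

lemma subspace_closure:
  assumes "subspace S"
  shows "subspace (closure S)"
proof (rule subspaceI)
  show "0 \<in> closure S"
    using assms subspace_0 closure_subset by blast
next
  fix x y assume "x \<in> closure S" "y \<in> closure S"
  then obtain X Y where "\<And>n. X n \<in> S" "X \<longlonglongrightarrow> x" "\<And>n. Y n \<in> S" "Y \<longlonglongrightarrow> y"
    unfolding closure_sequential by blast
  then have "\<forall>n. X n + Y n \<in> S" "(\<lambda>n. X n + Y n) \<longlonglongrightarrow> x + y"
    using assms by (auto intro: subspace_add tendsto_add)
  then show "x + y \<in> closure S"
    unfolding closure_sequential by (intro exI conjI)
next
  fix c x assume "x \<in> closure S"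
  then obtain X where "\<And>n. X n \<in> S" "X \<longlonglongrightarrow> x"
    unfolding closure_sequential by blast
  then have "\<forall>n. scale c (X n) \<in> S" "(\<lambda>n. scale c (X n)) \<longlonglongrightarrow> scale c x"
    using assms by (auto intro: subspace_scale tendsto_scale)
  then show "scale c x \<in> closure S"
    unfolding closure_sequential by (intro exI conjI)
qed

lemma closure_span_minimal:
  assumes "B \<subseteq> closure (span S)"
  shows "closure (span B) \<subseteq> closure (span S)"
proof -
  have "span B \<subseteq> closure (span S)"
    using assms by (intro span_minimal subspace_closure subspace_span)
  then show ?thesis
    by (simp add: closure_minimal)
qed

lemma closed_subspace_closure_span: "closed_subspace (closure (span S))"
  by (simp add: closed_subspace_def subspace_closure)

text \<open>The vectors orthogonal to \<open>y\<close> form a subspace, which is closed because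
  \<open>ip\<close> is continuous in its first argument.\<close>

lemma orthogonal_closure_span:
  assumes "\<And>x. x \<in> S \<Longrightarrow> ip x y = 0" and "z \<in> closure (span S)"
  shows "ip z y = 0"
proof -
  have sub: "subspace {x. ip x y = 0}"
    by (rule subspaceI) (auto simp: ip_add_left ip_scale_left)
  have "closed {x. ip x y = 0}"
    unfolding closed_sequential_limits
    using LIMSEQ_unique[OF tendsto_ip_left] by (fastforce simp: LIMSEQ_const_iff)
  moreover have "span S \<subseteq> {x. ip x y = 0}"
    using assms(1) by (intro span_minimal sub) auto
  ultimately show ?thesis
    using assms(2) closure_minimal by blast
qed

section \<open>Orthogonal projection onto a closed subspace\<close>

text \<open>A sequence in \<open>W\<close> minimising the distance to \<open>x\<close> is Cauchy by
  the parallelogram law; its limit is a nearest point, and minimality forces the residual to be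
  orthogonal to \<open>W\<close>. This gives the definite description in \<open>proj\<close> a
  witness.\<close>

lemma orthogonal_projection_exists:
  assumes "closed_subspace W"
  shows "\<exists>p\<in>W. \<forall>w\<in>W. ip (x - p) w = 0"
proof -
  have W: "subspace W" "closed W"
    using assms by (auto simp: closed_subspace_def)
  define d where "d = (INF w\<in>W. (norm (x - w))\<^sup>2)"
  have bdd: "bdd_below ((\<lambda>w. (norm (x - w))\<^sup>2) ` W)"
    by (rule bdd_belowI[of _ 0]) auto
  have d_le: "d \<le> (norm (x - w))\<^sup>2" if "w \<in> W" for w
    unfolding d_def by (rule cINF_lower[OF bdd that])
  have "\<exists>w\<in>W. (norm (x - w))\<^sup>2 < d + inverse (Suc n)" for n
  proof -
    have "d < d + inverse (Suc n)" by simp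
    moreover have "W \<noteq> {}"
      using W(1) subspace_0 by blast
    ultimately show ?thesis
      unfolding d_def using cINF_less_iff[OF _ bdd] by metis
  qed
  then obtain w where w: "\<And>n. w n \<in> W" "\<And>n. (norm (x - w n))\<^sup>2 < d + inverse (Suc n)"
    by metis
  have dist_w: "(norm (w m - w n))\<^sup>2 \<le> 2 * inverse (Suc m) + 2 * inverse (Suc n)" for m n
  proof -
    \<comment> \<open>The midpoint of two members of the sequence is again in \<open>W\<close>,
      hence no closer to \<open>x\<close> than \<open>d\<close> allows. The parallelogram law then
      leaves little room for the difference of the two.\<close>
    have "(1/2) *\<^sub>R (w m + w n) \<in> W"
      unfolding scale_of_real[symmetric]
      by (intro subspace_scale[OF W(1)] subspace_add[OF W(1)] w)
    then have "d \<le> (norm (x - (1/2) *\<^sub>R (w m + w n)))\<^sup>2"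
      by (rule d_le)
    also have "x - (1/2) *\<^sub>R (w m + w n) = (1/2) *\<^sub>R ((x - w m) + (x - w n))"
      by (simp add: algebra_simps flip: scaleR_add_left)
    also have "(norm \<dots>)\<^sup>2 = (norm ((x - w m) + (x - w n)))\<^sup>2 / 4"
      by (simp add: power2_eq_square)
    finally have "4 * d \<le> (norm ((x - w m) + (x - w n)))\<^sup>2"
      by simp
    then have "4 * d + (norm ((x - w m) - (x - w n)))\<^sup>2
        \<le> 2 * (norm (x - w m))\<^sup>2 + 2 * (norm (x - w n))\<^sup>2"
      using parallelogram[of "x - w m" "x - w n"] by simp
    moreover have "norm ((x - w m) - (x - w n)) = norm (w m - w n)"
      by (simp add: norm_minus_commute)
    ultimately show ?thesis
      using w(2)[of m] w(2)[of n] by simp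
  qed
  have "Cauchy w"
  proof (rule CauchyI)
    fix r :: real assume "0 < r"
    \<comment> \<open>Beyond \<open>N\<close> each of the two summands in \<open>dist_w\<close> is
      at most twice this inverse, so together they stay below the square of
      \<open>r\<close>.\<close>
    then obtain N where N: "inverse (real (Suc N)) < r\<^sup>2 / 4"
      using reals_Archimedean[of "r\<^sup>2 / 4"] by auto
    have "norm (w m - w n) < r" if "m \<ge> N" "n \<ge> N" for m n
    proof -
      have "inverse (real (Suc m)) \<le> inverse (real (Suc N))"
        "inverse (real (Suc n)) \<le> inverse (real (Suc N))"
        using that by (simp_all add: le_imp_inverse_le)
      then have "(norm (w m - w n))\<^sup>2 < r\<^sup>2"
        using dist_w[of m n] N by linarith
      then show ?thesis
        using \<open>0 < r\<close> by (simp add: power2_less_imp_less)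
    qed
    then show "\<exists>M. \<forall>m\<ge>M. \<forall>n\<ge>M. norm (w m - w n) < r"
      by blast
  qed
  then obtain p where p: "w \<longlonglongrightarrow> p"
    using Cauchy_convergent convergent_def by blast
  have "p \<in> W"
    using W(2) w(1) p closed_sequentially by blast
  have "(norm (x - p))\<^sup>2 \<le> d + 0"
  proof (rule LIMSEQ_le)
    show "(\<lambda>n. (norm (x - w n))\<^sup>2) \<longlonglongrightarrow> (norm (x - p))\<^sup>2"
      by (intro tendsto_intros p)
    show "(\<lambda>n. d + inverse (real (Suc n))) \<longlonglongrightarrow> d + 0"
      by (intro tendsto_add tendsto_const LIMSEQ_inverse_real_of_nat)
    show "\<exists>N. \<forall>n\<ge>N. (norm (x - w n))\<^sup>2 \<le> d + inverse (real (Suc n))"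
      using w(2) less_imp_le by blast
  qed
  have "ip (x - p) v = 0" if "v \<in> W" for v
  proof (cases "v = 0")
    case False
    \<comment> \<open>Moving \<open>p\<close> by the component of \<open>x - p\<close> along
      \<open>v\<close> stays inside \<open>W\<close>; a nonzero component would bring the squared
      distance below \<open>d\<close>.\<close>
    let ?c = "ip (x - p) v / ip v v"
    have "p + scale ?c v \<in> W"
      using W(1) \<open>p \<in> W\<close> that by (intro subspace_add subspace_scale)
    then have "d \<le> (norm (x - p - scale ?c v))\<^sup>2"
      using d_le by (metis diff_diff_add)
    then have "(norm (ip (x - p) v) / norm v)\<^sup>2 \<le> 0"
      using norm_diff_component(2)[OF False, of "x - p"] \<open>(norm (x - p))\<^sup>2 \<le> d + 0\<close> by linarith
    then show ?thesis
      using False by simp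
  qed simp
  with \<open>p \<in> W\<close> show ?thesis by blast
qed

lemma proj_eqI:
  assumes "closed_subspace W" and "p \<in> W" and "\<And>w. w \<in> W \<Longrightarrow> ip (x - p) w = 0"
  shows "proj W x = p"
  unfolding proj_def
proof (rule the_equality)
  fix q assume q: "q \<in> W \<and> (\<forall>w\<in>W. ip (x - q) w = 0)"
  then have "p - q \<in> W"
    using assms by (simp add: closed_subspace_def subspace_diff)
  then have "ip (x - q) (p - q) = 0" "ip (x - p) (p - q) = 0"
    using q assms by auto
  \<comment> \<open>The first argument equals \<open>p - q\<close>, so this vector is orthogonal to
    itself.\<close>
  then have "ip ((x - q) - (x - p)) (p - q) = 0"
    by (simp only: ip_diff_left diff_0_right)
  then show "q = p"
    by (simp add: ip_self)
qed (use assms in auto)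

lemma proj_orthogonal:
  assumes "closed_subspace W" and "w \<in> W"
  shows "ip (x - proj W x) w = 0"
proof -
  obtain p where "p \<in> W" "\<forall>w\<in>W. ip (x - p) w = 0"
    using orthogonal_projection_exists[OF assms(1)] by blast
  then show ?thesis
    using proj_eqI[OF assms(1), of p x] assms(2) by simp
qed

section \<open>Bounded operators and their extension from a dense span\<close>

lemma bounded_operator_module_hom: "bounded_operator T \<Longrightarrow> module_hom scale scale T"
  by (simp add: bounded_operator_def module_hom_iff_linear)

lemma bounded_operator_tendsto:
  assumes "bounded_operator T" and "(X \<longlongrightarrow> x) F"
  shows "((\<lambda>n. T (X n)) \<longlongrightarrow> T x) F"
proof -
  obtain B where B: "\<And>x. norm (T x) \<le> B * norm x"
    using assms(1) unfolding bounded_operator_def by blast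
  have "((\<lambda>n. T (X n) - T x) \<longlongrightarrow> 0) F"
  proof (rule Lim_null_comparison)
    show "\<forall>\<^sub>F n in F. norm (T (X n) - T x) \<le> B * norm (X n - x)"
      using B[of "X _ - x"] by (simp add: module_hom.diff[OF bounded_operator_module_hom[OF assms(1)]])
    have "((\<lambda>n. B * norm (X n - x)) \<longlongrightarrow> B * norm (x - x)) F"
      by (intro tendsto_intros assms)
    then show "((\<lambda>n. B * norm (X n - x)) \<longlongrightarrow> 0) F"
      by simp
  qed
  then show ?thesis
    by (simp add: LIM_zero_iff)
qed

lemma bounded_operator_continuous: "bounded_operator T \<Longrightarrow> continuous_on S T"
  by (simp add: continuous_on_def bounded_operator_tendsto[OF _ tendsto_ident_at])

text \<open>Continuity alone gives just this inclusion. For an invertible operator the reverse one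
  comes from applying the lemma to the inverse.\<close>

lemma bounded_operator_image_closure_span:
  assumes "bounded_operator T"
  shows "T ` closure (span S) \<subseteq> closure (span (T ` S))"
proof (rule image_closure_subset[OF bounded_operator_continuous[OF assms] closed_closure])
  show "T ` span S \<subseteq> closure (span (T ` S))"
    by (simp add: module_hom.span_image[OF bounded_operator_module_hom[OF assms]] closure_subset)
qed

lemma bounded_operator_eq_on_dense:
  assumes "bounded_operator T" and "bounded_operator S" and "closure (span B) = UNIV"
    and "\<And>b. b \<in> B \<Longrightarrow> T b = S b"
  shows "T = S"
proof -
  interpret module_pair scale scale ..
  have *: "T x = S x" if "x \<in> span B" for x
    by (rule module_hom_eq_on_span[OF assms(1,2)[THEN bounded_operator_module_hom] assms(4) that])
  show ?thesis
  proof
    fix x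
    obtain X where X: "\<And>n. X n \<in> span B" "X \<longlonglongrightarrow> x"
      using assms(3) closure_sequential[of x "span B"] by auto
    have "(\<lambda>n. T (X n)) \<longlonglongrightarrow> T x" "(\<lambda>n. T (X n)) \<longlonglongrightarrow> S x"
      using bounded_operator_tendsto[OF assms(1) X(2)] bounded_operator_tendsto[OF assms(2) X(2)]
        *[OF X(1)] by simp_all
    then show "T x = S x"
      by (rule LIMSEQ_unique)
  qed
qed

lemma bounded_operator_id: "bounded_operator id"
  unfolding bounded_operator_def using linear_id by (auto intro: exI[of _ 1])

lemma bounded_operator_compose:
  assumes "bounded_operator S" and "bounded_operator T"
  shows "bounded_operator (S \<circ> T)"
proof -
  obtain B where B: "\<And>x. norm (S x) \<le> B * norm x"
    using assms(1) unfolding bounded_operator_def by blast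
  obtain C where C: "\<And>x. norm (T x) \<le> C * norm x"
    using assms(2) unfolding bounded_operator_def by blast
  \<comment> \<open>The constant \<open>B\<close> may be negative, so its absolute value is taken
    before multiplying the second estimate by it.\<close>
  have "norm ((S \<circ> T) x) \<le> \<bar>B\<bar> * C * norm x" for x
  proof -
    have "norm ((S \<circ> T) x) \<le> \<bar>B\<bar> * norm (T x)"
      using B[of "T x"] by (simp add: order_trans[OF _ mult_right_mono[OF abs_ge_self]])
    also have "\<dots> \<le> \<bar>B\<bar> * (C * norm x)"
      by (intro mult_left_mono C) simp
    finally show ?thesis by simp
  qed
  then show ?thesis
    using Vector_Spaces.linear_compose assms unfolding bounded_operator_def by blast
qed

text \<open>The operator is the closure of the graph spanned by the pairs \<open>(f a, g a)\<close>.\<close>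

lemma bounded_operator_extension:
  assumes dense: "closure (span (f ` A)) = UNIV"
    and bound: "\<And>F c. finite F \<Longrightarrow> F \<subseteq> A \<Longrightarrow>
      norm (\<Sum>a\<in>F. scale (c a) (g a)) \<le> C * norm (\<Sum>a\<in>F. scale (c a) (f a))"
  shows "\<exists>T. bounded_operator T \<and> (\<forall>a\<in>A. T (f a) = g a)"
proof -
  interpret P: vector_space "\<lambda>c (x, y). (scale c x, scale c y)"
    by unfold_locales (auto simp: scale_right_distrib scale_left_distrib)
  \<comment> \<open>Different coefficients may give the same combination of the \<open>f a\<close>.
    Working with the graph avoids choosing coefficients; the norm bound will make it
    single-valued.\<close>
  define G where "G = P.span ((\<lambda>a. (f a, g a)) ` A)"
  have G_bound: "norm y \<le> C * norm x" if "(x, y) \<in> G" for x y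
  proof -
    have "(x, y) \<in> P.span ((\<lambda>a. (f a, g a)) ` A)"
      using that by (simp add: G_def)
    then obtain F c where F: "finite F" "F \<subseteq> A"
      and xy: "(x, y) = (\<Sum>a\<in>F. case (f a, g a) of (x, y) \<Rightarrow> (scale (c a) x, scale (c a) y))"
      by (rule P.span_image_finite_sums)
    have "x = (\<Sum>a\<in>F. scale (c a) (f a))" "y = (\<Sum>a\<in>F. scale (c a) (g a))"
      using arg_cong[OF xy, of fst] arg_cong[OF xy, of snd] by (simp_all add: fst_sum snd_sum)
    then show ?thesis
      using bound[OF F] by simp
  qed
  have G_add: "(x + x', y + y') \<in> G" if "(x, y) \<in> G" "(x', y') \<in> G" for x y x' y'
    using P.span_add[of "(x, y)" _ "(x', y')"] that by (simp add: G_def)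
  have G_scale: "(scale c x, scale c y) \<in> G" if "(x, y) \<in> G" for c x y
    using P.span_scale[of "(x, y)" _ c] that by (simp add: G_def)
  have G_dom: "\<exists>y. (x, y) \<in> G" if "x \<in> span (f ` A)" for x
    using that
  proof (induction rule: span_induct_alt)
    case base
    then show ?case
      using P.span_zero by (auto simp: G_def zero_prod_def)
  next
    case (step c v x)
    then obtain a y where "a \<in> A" "v = f a" "(x, y) \<in> G"
      by blast
    then have "(v, g a) \<in> G"
      by (auto simp: G_def intro: P.span_base)
    then show ?case
      using G_add[OF G_scale] \<open>(x, y) \<in> G\<close> by blast
  qed
  \<comment> \<open>The sequential closure of \<open>G\<close>; bound and linearity pass to the
    limit, and density of the domain makes it total.\<close>
  define R where "R x y \<longleftrightarrow> (\<exists>X Y. (\<forall>n. (X n, Y n) \<in> G) \<and> X \<longlonglongrightarrow> x \<and> Y \<longlonglongrightarrow> y)" for x y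
  have R_bound: "norm y \<le> C * norm x" if "R x y" for x y
  proof -
    obtain X Y where XY: "\<And>n. (X n, Y n) \<in> G" "X \<longlonglongrightarrow> x" "Y \<longlonglongrightarrow> y"
      using \<open>R x y\<close> unfolding R_def by blast
    show ?thesis
    proof (rule LIMSEQ_le)
      show "(\<lambda>n. norm (Y n)) \<longlonglongrightarrow> norm y" "(\<lambda>n. C * norm (X n)) \<longlonglongrightarrow> C * norm x"
        by (intro tendsto_intros XY)+
      show "\<exists>N. \<forall>n\<ge>N. norm (Y n) \<le> C * norm (X n)"
        using G_bound[OF XY(1)] by blast
    qed
  qed
  have R_add: "R (x + x') (y + y')" if "R x y" "R x' y'" for x y x' y'
  proof -
    obtain X Y X' Y' where "\<And>n. (X n, Y n) \<in> G" "X \<longlonglongrightarrow> x" "Y \<longlonglongrightarrow> y"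
      "\<And>n. (X' n, Y' n) \<in> G" "X' \<longlonglongrightarrow> x'" "Y' \<longlonglongrightarrow> y'"
      using \<open>R x y\<close> \<open>R x' y'\<close> unfolding R_def by blast
    then show ?thesis
      unfolding R_def
      by (intro exI[of _ "\<lambda>n. X n + X' n"] exI[of _ "\<lambda>n. Y n + Y' n"]) (simp add: G_add tendsto_add)
  qed
  have R_scale: "R (scale c x) (scale c y)" if "R x y" for c x y
  proof -
    obtain X Y where "\<And>n. (X n, Y n) \<in> G" "X \<longlonglongrightarrow> x" "Y \<longlonglongrightarrow> y"
      using \<open>R x y\<close> unfolding R_def by blast
    then show ?thesis
      unfolding R_def
      by (intro exI[of _ "\<lambda>n. scale c (X n)"] exI[of _ "\<lambda>n. scale c (Y n)"])
        (simp add: G_scale tendsto_scale)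
  qed
  \<comment> \<open>By linearity \<open>R\<close> relates 0 to \<open>y - y'\<close>, and
    \<open>R_bound\<close> leaves this difference no norm.\<close>
  have R_unique: "y = y'" if "R x y" "R x y'" for x y y'
  proof -
    have "R (x + scale (- 1) x) (y + scale (- 1) y')"
      using that by (intro R_add R_scale)
    then show ?thesis
      using R_bound by fastforce
  qed
  have R_total: "\<exists>y. R x y" for x
  proof -
    obtain X where X: "\<And>n. X n \<in> span (f ` A)" "X \<longlonglongrightarrow> x"
      using dense closure_sequential[of x "span (f ` A)"] by auto
    have "\<forall>n. \<exists>y. (X n, y) \<in> G"
      using G_dom X(1) by blast
    then obtain Y where Y: "\<And>n. (X n, Y n) \<in> G"
      using choice[of "\<lambda>n y. (X n, y) \<in> G"] by blast
    have *: "norm (Y m - Y n) \<le> C * norm (X m - X n)" for m n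
      using G_bound[OF G_add[OF Y[of m] G_scale[OF Y[of n], of "- 1"]]] by simp
    have "Cauchy Y"
    proof (rule CauchyI)
      fix r :: real assume "0 < r"
      \<comment> \<open>Adding 1 keeps the denominator positive even for
        \<open>C = 0\<close>.\<close>
      then have "0 < r / (\<bar>C\<bar> + 1)" by simp
      then obtain N where N: "\<And>m n. m \<ge> N \<Longrightarrow> n \<ge> N \<Longrightarrow> norm (X m - X n) < r / (\<bar>C\<bar> + 1)"
        using CauchyD[OF LIMSEQ_imp_Cauchy[OF X(2)]] by blast
      have "norm (Y m - Y n) < r" if "m \<ge> N" "n \<ge> N" for m n
      proof -
        have "norm (Y m - Y n) \<le> (\<bar>C\<bar> + 1) * norm (X m - X n)"
          by (rule order_trans[OF *]) (auto intro: mult_right_mono)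
        also have "\<dots> < r"
          using N[OF that] by (simp add: pos_less_divide_eq mult.commute)
        finally show ?thesis .
      qed
      then show "\<exists>M. \<forall>m\<ge>M. \<forall>n\<ge>M. norm (Y m - Y n) < r"
        by blast
    qed
    then obtain y where "Y \<longlonglongrightarrow> y"
      using Cauchy_convergent convergent_def by blast
    then show ?thesis
      unfolding R_def using X Y by blast
  qed
  obtain T where T: "\<And>x. R x (T x)"
    using R_total by metis
  have "Vector_Spaces.linear scale scale T"
    unfolding Vector_Spaces.linear_iff
    by (intro conjI allI vector_space_axioms R_unique[OF T] R_add R_scale T)
  then have "bounded_operator T"
    unfolding bounded_operator_def using R_bound[OF T] by blast
  moreover have "T (f a) = g a" if "a \<in> A" for a
  proof (rule R_unique[OF T])
    have "(f a, g a) \<in> G"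
      using that by (auto simp: G_def intro: P.span_base)
    then show "R (f a) (g a)"
      unfolding R_def by (intro exI[of _ "\<lambda>n. f a"] exI[of _ "\<lambda>n. g a"]) simp
  qed
  ultimately show ?thesis by blast
qed

section \<open>Gram-Schmidt over a countable index set\<close>

text \<open>The projection must lie in the span itself and not just in its closure, because
  \<open>gram_schmidt\<close> has to preserve algebraic spans.\<close>

lemma projection_onto_finite_span:
  assumes "finite F"
  shows "\<exists>p\<in>span F. \<forall>w\<in>span F. ip (x - p) w = 0"
proof -
  have "\<forall>x. \<exists>p\<in>span F. \<forall>w\<in>F. ip (x - p) w = 0"
    using assms
  proof (induction F rule: finite_induct)
    case (insert a F)
    show ?case
    proof
      fix x
      have mono: "y \<in> span (insert a F)" if "y \<in> span F" for y
        using that span_mono[of F "insert a F"] by blast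
      obtain q where q: "q \<in> span F" "\<forall>w\<in>F. ip (a - q) w = 0"
        using insert.IH by blast
      obtain p where p: "p \<in> span F" "\<forall>w\<in>F. ip (x - p) w = 0"
        using insert.IH by blast
      \<comment> \<open>The residual of the new vector \<open>a\<close> is the one new direction
        orthogonal to \<open>F\<close>. If \<open>a\<close> already lies in the span of
        \<open>F\<close>, it is 0, and division by zero makes the coefficient 0 as well.\<close>
      let ?g = "a - q"
      let ?c = "ip (x - p) ?g / ip ?g ?g"
      let ?z = "x - (p + scale ?c ?g)"
      have gF: "ip ?z w = 0" if "w \<in> F" for w
        using that p(2) q(2) by (simp add: diff_diff_add[symmetric] ip_diff_left ip_scale_left)
      have zq: "ip ?z q = 0"
        using orthogonal_closure_span[of F ?z q] gF q(1) closure_subset ip_zero_commute by blast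
      have "ip ?z ?g = 0"
      proof (cases "?g = 0")
        case False
        then show ?thesis
          using norm_diff_component(1)[OF False, of "x - p"] by (simp add: diff_diff_add)
      qed simp
      then have "ip ?z a = 0"
        using zq by (simp only: ip_diff_right diff_0_right)
      moreover have "p + scale ?c ?g \<in> span (insert a F)"
        by (intro span_add span_scale span_diff mono p(1) q(1) span_base insertI1)
      ultimately show "\<exists>p\<in>span (insert a F). \<forall>w\<in>insert a F. ip (x - p) w = 0"
        using gF by blast
    qed
  qed (auto intro: span_zero)
  then obtain p where p: "p \<in> span F" "\<And>w. w \<in> F \<Longrightarrow> ip (x - p) w = 0"
    by blast
  then have "ip (x - p) w = 0" if "w \<in> span F" for w
    using orthogonal_closure_span[of F "x - p" w] that closure_subset ip_zero_commute by blast
  with p(1) show ?thesis by blast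
qed

text \<open>The orthonormal family keeps the index set \<open>A\<close>, so that \<open>u a\<close>
  can be matched with \<open>f a\<close>. An enumeration of \<open>A\<close> orders the indices, and
  each \<open>f a\<close> is reduced by its projection onto the span of its predecessors and
  normalised.\<close>

lemma gram_schmidt:
  assumes "countable A"
    and indep: "\<And>F a. finite F \<Longrightarrow> F \<subseteq> A \<Longrightarrow> a \<in> A - F \<Longrightarrow> f a \<notin> span (f ` F)"
  shows "\<exists>u. (\<forall>a\<in>A. \<forall>b\<in>A. ip (u a) (u b) = (if a = b then 1 else 0)) \<and> span (u ` A) = span (f ` A)"
proof -
  define r where "r = to_nat_on A"
  have inj: "inj_on r A"
    unfolding r_def using assms(1) by (rule inj_on_to_nat_on)
  define P where "P a = {b\<in>A. r b < r a}" for a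
  \<comment> \<open>The enumeration maps the predecessors of \<open>a\<close> injectively into the
    numbers below \<open>r a\<close>.\<close>
  have P_finite: "finite (P a)" for a
    by (rule inj_on_finite[of r _ "{..<r a}"]) (auto simp: P_def intro: inj_on_subset[OF inj])
  have "\<forall>a. \<exists>p\<in>span (f ` P a). \<forall>w\<in>span (f ` P a). ip (f a - p) w = 0"
    using projection_onto_finite_span[OF finite_imageI[OF P_finite]] by blast
  then obtain q where q: "\<And>a. q a \<in> span (f ` P a)"
    "\<And>a w. w \<in> span (f ` P a) \<Longrightarrow> ip (f a - q a) w = 0"
    by metis
  define u where "u a = scale (of_real (inverse (norm (f a - q a)))) (f a - q a)" for a
  \<comment> \<open>A zero residual would put \<open>f a\<close> into the span of finitely many
    other members, against \<open>indep\<close>.\<close>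
  have nz: "f a - q a \<noteq> 0" if "a \<in> A" for a
    using indep[OF P_finite, of a a] that q(1)[of a] by (auto simp: P_def)
  have norm_u: "ip (u a) (u a) = 1" if "a \<in> A" for a
  proof -
    have "norm (u a) = 1"
      using nz[OF that] unfolding u_def norm_scale norm_of_real by simp
    then show ?thesis
      by (simp add: ip_self)
  qed
  have u_in: "u b \<in> span (f ` insert b (P b))" for b
  proof -
    have "q b \<in> span (f ` insert b (P b))"
      using q(1)[of b] span_mono[of "f ` P b" "f ` insert b (P b)"] by blast
    then show ?thesis
      unfolding u_def by (intro span_scale span_diff) (auto intro: span_base)
  qed
  have orth: "ip (u a) (u b) = 0" if "b \<in> A" "r b < r a" for a b
  proof -
    have "insert b (P b) \<subseteq> P a"
      using that by (auto simp: P_def)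
    then have "u b \<in> span (f ` P a)"
      using u_in[of b] span_mono[of "f ` insert b (P b)" "f ` P a"] by blast
    then show ?thesis
      using q(2)[of "u b" a] by (simp add: u_def[of a] ip_scale_left)
  qed
  have "ip (u a) (u b) = (if a = b then 1 else 0)" if "a \<in> A" "b \<in> A" for a b
  proof (cases "a = b")
    case False
    then have "r a < r b \<or> r b < r a"
      using inj that by (meson inj_onD linorder_neqE_nat)
    then show ?thesis
      using False orth[of a b] orth[of b a] that ip_zero_commute[of "u a" "u b"] by auto
  qed (use norm_u that in auto)
  moreover have "span (u ` A) = span (f ` A)"
  proof
    have "insert b (P b) \<subseteq> A" if "b \<in> A" for b
      using that by (auto simp: P_def)
    then have "u ` A \<subseteq> span (f ` A)"
      using u_in span_mono[OF image_mono] by blast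
    then show "span (u ` A) \<subseteq> span (f ` A)"
      by (intro span_minimal) auto
    \<comment> \<open>Induction on the rank of \<open>a\<close>: \<open>f a\<close> is a multiple of
      \<open>u a\<close> plus \<open>q a\<close>, and \<open>q a\<close> is built from
      predecessors.\<close>
    have "f a \<in> span (u ` A)" if "a \<in> A" for a
      using that
    proof (induction "r a" arbitrary: a rule: less_induct)
      case less
      have "f ` P a \<subseteq> span (u ` A)"
        using less(1) by (auto simp: P_def)
      then have "q a \<in> span (u ` A)"
        using q(1)[of a] span_minimal[of "f ` P a" "span (u ` A)"] by auto
      moreover have "f a = scale (of_real (norm (f a - q a))) (u a) + q a"
        using nz[OF less(2)] by (simp add: u_def flip: of_real_mult)
      ultimately show ?case
        using less(2) by (metis span_add span_scale span_base imageI)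
    qed
    then show "span (f ` A) \<subseteq> span (u ` A)"
      by (intro span_minimal) auto
  qed
  ultimately show ?thesis by blast
qed

section \<open>A Riesz basis from two-sided coefficient bounds\<close>

text \<open>For an orthonormal \<open>u\<close> over \<open>A\<close>, the sum of the squared
  coefficients is the squared norm of the combination of the \<open>u a\<close>. So
  \<open>upper\<close> bounds the map from \<open>u\<close> to \<open>f\<close> and
  \<open>lower\<close> the map back; both compositions fix a family with dense span.\<close>

lemma riesz_basisI:
  assumes "countable A" and dense: "closure (span (f ` A)) = UNIV" and "0 \<le> K" and "0 \<le> L"
    and upper: "\<And>F c. finite F \<Longrightarrow> F \<subseteq> A \<Longrightarrow>
      (norm (\<Sum>a\<in>F. scale (c a) (f a)))\<^sup>2 \<le> K\<^sup>2 * (\<Sum>a\<in>F. (norm (c a))\<^sup>2)"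
    and lower: "\<And>F c. finite F \<Longrightarrow> F \<subseteq> A \<Longrightarrow>
      (\<Sum>a\<in>F. (norm (c a))\<^sup>2) \<le> L\<^sup>2 * (norm (\<Sum>a\<in>F. scale (c a) (f a)))\<^sup>2"
  shows "riesz_basis A f"
proof -
  have "f a \<notin> span (f ` F)" if "finite F" "F \<subseteq> A" "a \<in> A - F" for F a
  proof
    assume "f a \<in> span (f ` F)"
    then obtain G c where G: "finite G" "G \<subseteq> F" and fa: "f a = (\<Sum>b\<in>G. scale (c b) (f b))"
      by (rule span_image_finite_sums)
    \<comment> \<open>Coefficient -1 at \<open>a\<close> turns the dependence into a combination
      equal to 0 whose squared coefficients sum to at least 1, contradicting
      \<open>lower\<close>.\<close>
    let ?c = "\<lambda>b. if b = a then - 1 else c b"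
    have "a \<notin> G"
      using G(2) that(3) by blast
    then have "(\<Sum>b\<in>G. scale (?c b) (f b)) = f a"
      unfolding fa by (intro sum.cong) auto
    then have "(\<Sum>b\<in>insert a G. scale (?c b) (f b)) = 0"
      using \<open>a \<notin> G\<close> G(1) by simp
    then have "(\<Sum>b\<in>insert a G. (norm (?c b))\<^sup>2) \<le> 0"
      using lower[of "insert a G" ?c] G that by auto
    moreover have "(\<Sum>b\<in>insert a G. (norm (?c b))\<^sup>2) = 1 + (\<Sum>b\<in>G. (norm (?c b))\<^sup>2)"
      using \<open>a \<notin> G\<close> G(1) by simp
    moreover have "0 \<le> (\<Sum>b\<in>G. (norm (?c b))\<^sup>2)"
      by (intro sum_nonneg) simp
    ultimately show False by linarith
  qed
  then obtain u where u: "\<And>a b. a \<in> A \<Longrightarrow> b \<in> A \<Longrightarrow> ip (u a) (u b) = (if a = b then 1 else 0)"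
    and span_u: "span (u ` A) = span (f ` A)"
    using gram_schmidt[OF assms(1), of f] by metis
  have dense_u: "closure (span (u ` A)) = UNIV"
    by (simp add: span_u dense)
  have norm_u: "(norm (\<Sum>a\<in>F. scale (c a) (u a)))\<^sup>2 = (\<Sum>a\<in>F. (norm (c a))\<^sup>2)"
    if "finite F" "F \<subseteq> A" for F c
    by (intro norm_sum_orthonormal that(1) u subsetD[OF that(2)])
  have "norm (\<Sum>a\<in>F. scale (c a) (f a)) \<le> K * norm (\<Sum>a\<in>F. scale (c a) (u a))"
    if "finite F" "F \<subseteq> A" for F c
    by (rule power2_le_imp_le)
      (use upper[OF that, of c] \<open>0 \<le> K\<close> in \<open>simp_all add: power_mult_distrib norm_u[OF that]\<close>)
  then obtain T where T: "bounded_operator T" "\<And>a. a \<in> A \<Longrightarrow> T (u a) = f a"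
    using bounded_operator_extension[OF dense_u, of f K] by blast
  have "norm (\<Sum>a\<in>F. scale (c a) (u a)) \<le> L * norm (\<Sum>a\<in>F. scale (c a) (f a))"
    if "finite F" "F \<subseteq> A" for F c
    by (rule power2_le_imp_le)
      (use lower[OF that, of c] \<open>0 \<le> L\<close> in \<open>simp_all add: power_mult_distrib norm_u[OF that]\<close>)
  then obtain S where S: "bounded_operator S" "\<And>a. a \<in> A \<Longrightarrow> S (f a) = u a"
    using bounded_operator_extension[OF dense, of u L] by blast
  have "S \<circ> T = id"
    by (rule bounded_operator_eq_on_dense[OF bounded_operator_compose[OF S(1) T(1)] bounded_operator_id dense_u])
      (auto simp: S(2) T(2))
  moreover have "T \<circ> S = id"
    by (rule bounded_operator_eq_on_dense[OF bounded_operator_compose[OF T(1) S(1)] bounded_operator_id dense])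
      (auto simp: S(2) T(2))
  ultimately have "bounded_invertible_operator T"
    using S(1) T(1) unfolding bounded_invertible_operator_def by blast
  then show ?thesis
    unfolding riesz_basis_def orthonormal_basis_def using u dense_u T(2) by blast
qed

section \<open>From a Riesz f-basis to a Riesz basis\<close>

lemma bounded_operator_bound:
  assumes "bounded_operator T"
  obtains B where "0 \<le> B" "\<And>x. (norm (T x))\<^sup>2 \<le> B\<^sup>2 * (norm x)\<^sup>2"
proof -
  obtain B where B: "\<And>x. norm (T x) \<le> B * norm x"
    using assms unfolding bounded_operator_def by blast
  have "norm (T x) \<le> \<bar>B\<bar> * norm x" for x
    using B[of x] mult_right_mono[OF abs_ge_self[of B], of "norm x"] by simp
  then have "(norm (T x))\<^sup>2 \<le> (\<bar>B\<bar> * norm x)\<^sup>2" for x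
    by (intro power_mono) auto
  then show ?thesis
    using that[of "\<bar>B\<bar>"] by (simp add: power_mult_distrib)
qed

text \<open>Since \<open>x\<close> projects to 0 on \<open>V j\<close>, it is its own residual, and
  residuals are orthogonal to \<open>V j\<close>.\<close>

lemma orthonormal_fbasis_orthogonal:
  assumes "orthonormal_fbasis J V" and "i \<in> J" "j \<in> J" "i \<noteq> j" and "x \<in> V i" "y \<in> V j"
  shows "ip x y = 0"
proof -
  have "closed_subspace (V j)" "proj (V j) x = 0"
    using assms unfolding orthonormal_fbasis_def by auto
  then show ?thesis
    using proj_orthogonal[of "V j" y x] assms(6) by simp
qed

text \<open>The inverse \<open>S\<close> pulls each \<open>w j\<close> back into \<open>V j\<close>,
  where Pythagoras is exact; passing between \<open>w j\<close> and \<open>S (w j)\<close> costs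
  only the bounds of \<open>T\<close> and \<open>S\<close>.\<close>

lemma riesz_fbasis_bounds:
  assumes "riesz_fbasis J W"
  shows "\<exists>K\<ge>0. \<forall>F w. finite F \<longrightarrow> F \<subseteq> J \<longrightarrow> (\<forall>j\<in>F. w j \<in> W j) \<longrightarrow>
    (norm (sum w F))\<^sup>2 \<le> K\<^sup>2 * (\<Sum>j\<in>F. (norm (w j))\<^sup>2) \<and>
    (\<Sum>j\<in>F. (norm (w j))\<^sup>2) \<le> K\<^sup>2 * (norm (sum w F))\<^sup>2"
proof -
  obtain V T S where V: "orthonormal_fbasis J V" and TW: "\<And>j. j \<in> J \<Longrightarrow> T ` V j = W j"
    and T: "bounded_operator T" and S: "bounded_operator S" and inv: "S \<circ> T = id" "T \<circ> S = id"
    using assms unfolding riesz_fbasis_def bounded_invertible_operator_def by blast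
  have ST: "S (T x) = x" and TS: "T (S x) = x" for x
    using inv[THEN fun_cong, of x] by simp_all
  obtain B where B: "0 \<le> B" "\<And>x. (norm (T x))\<^sup>2 \<le> B\<^sup>2 * (norm x)\<^sup>2"
    using bounded_operator_bound[OF T] by blast
  obtain C where C: "0 \<le> C" "\<And>x. (norm (S x))\<^sup>2 \<le> C\<^sup>2 * (norm x)\<^sup>2"
    using bounded_operator_bound[OF S] by blast
  have pyth: "(norm (S (sum w F)))\<^sup>2 = (\<Sum>j\<in>F. (norm (S (w j)))\<^sup>2)"
    if "finite F" "F \<subseteq> J" "\<And>j. j \<in> F \<Longrightarrow> w j \<in> W j" for F w
  proof -
    have "S (w j) \<in> V j" if "j \<in> F" for j
    proof -
      have "w j \<in> T ` V j"
        using that \<open>F \<subseteq> J\<close> TW \<open>\<And>j. j \<in> F \<Longrightarrow> w j \<in> W j\<close> by blast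
      then show ?thesis
        by (auto simp: ST)
    qed
    then have "(norm (\<Sum>j\<in>F. S (w j)))\<^sup>2 = (\<Sum>j\<in>F. (norm (S (w j)))\<^sup>2)"
      using that(1,2) orthonormal_fbasis_orthogonal[OF V] by (intro norm_sum_orthogonal) blast+
    then show ?thesis
      by (simp add: module_hom.sum[OF bounded_operator_module_hom[OF S]])
  qed
  show ?thesis
  \<comment> \<open>One constant serves both estimates: the first uses the bound of \<open>T\<close>
    on the whole sum and that of \<open>S\<close> on each term, the second the other way
    round.\<close>
  proof (intro exI[of _ "B * C"] conjI allI impI)
    fix F w assume "finite F" "F \<subseteq> J" "\<forall>j\<in>F. w j \<in> W j"
    then have F: "finite F" "F \<subseteq> J" "\<And>j. j \<in> F \<Longrightarrow> w j \<in> W j"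
      by auto
    have "(norm (sum w F))\<^sup>2 \<le> B\<^sup>2 * (norm (S (sum w F)))\<^sup>2"
      using B(2)[of "S (sum w F)"] by (simp add: TS)
    also have "\<dots> = B\<^sup>2 * (\<Sum>j\<in>F. (norm (S (w j)))\<^sup>2)"
      using pyth[OF F] by simp
    also have "\<dots> \<le> B\<^sup>2 * (\<Sum>j\<in>F. C\<^sup>2 * (norm (w j))\<^sup>2)"
      by (intro mult_left_mono sum_mono C(2)) simp
    finally show "(norm (sum w F))\<^sup>2 \<le> (B * C)\<^sup>2 * (\<Sum>j\<in>F. (norm (w j))\<^sup>2)"
      by (simp add: power_mult_distrib sum_distrib_left mult.assoc)
    have "(\<Sum>j\<in>F. (norm (w j))\<^sup>2) \<le> (\<Sum>j\<in>F. B\<^sup>2 * (norm (S (w j)))\<^sup>2)"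
      using B(2)[of "S (w _)"] by (intro sum_mono) (simp add: TS)
    also have "\<dots> = B\<^sup>2 * (norm (S (sum w F)))\<^sup>2"
      using pyth[OF F] by (simp add: sum_distrib_left)
    also have "\<dots> \<le> B\<^sup>2 * (C\<^sup>2 * (norm (sum w F))\<^sup>2)"
      by (intro mult_left_mono C(2)) simp
    finally show "(\<Sum>j\<in>F. (norm (w j))\<^sup>2) \<le> (B * C)\<^sup>2 * (norm (sum w F))\<^sup>2"
      by (simp add: power_mult_distrib mult.assoc)
  qed (use B C in auto)
qed

text \<open>By continuity \<open>T\<close> maps the closed span of the \<open>V j\<close> into that
  of the \<open>W j\<close>, and \<open>T\<close> is onto.\<close>

lemma riesz_fbasis_dense:
  assumes "riesz_fbasis J W"
  shows "closure (span (\<Union>j\<in>J. W j)) = UNIV"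
proof -
  obtain V T where "orthonormal_fbasis J V" "bounded_invertible_operator T"
    and TW: "\<And>j. j \<in> J \<Longrightarrow> T ` V j = W j"
    using assms unfolding riesz_fbasis_def by blast
  then obtain S where V: "closure (span (\<Union>j\<in>J. V j)) = UNIV"
    and T: "bounded_operator T" and inv: "T \<circ> S = id"
    unfolding orthonormal_fbasis_def bounded_invertible_operator_def by metis
  have "T ` (\<Union>j\<in>J. V j) = (\<Union>j\<in>J. W j)"
    unfolding image_UN using TW by (intro SUP_cong refl)
  then have "range T \<subseteq> closure (span (\<Union>j\<in>J. W j))"
    using bounded_operator_image_closure_span[OF T, of "\<Union>j\<in>J. V j"] V by simp
  moreover have "surj T"
    using inv by (metis comp_apply id_apply surjI)
  ultimately show ?thesis by auto
qed

lemma riesz_fbasis_imp_riesz_basis: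
  assumes "countable J" and "\<And>j. j \<in> J \<Longrightarrow> countable (I j)"
    and e: "\<And>j. j \<in> J \<Longrightarrow> orthonormal_basis (I j) (\<lambda>i. e i j) (W j)"
    and W: "riesz_fbasis J W"
  shows "riesz_basis (SIGMA j:J. I j) (\<lambda>(j, i). e i j)"
proof -
  let ?A = "SIGMA j:J. I j" and ?f = "\<lambda>(j, i). e i j"
  obtain K where K: "0 \<le> K" "\<forall>F w. finite F \<longrightarrow> F \<subseteq> J \<longrightarrow> (\<forall>j\<in>F. w j \<in> W j) \<longrightarrow>
      (norm (sum w F))\<^sup>2 \<le> K\<^sup>2 * (\<Sum>j\<in>F. (norm (w j))\<^sup>2) \<and>
      (\<Sum>j\<in>F. (norm (w j))\<^sup>2) \<le> K\<^sup>2 * (norm (sum w F))\<^sup>2"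
    using riesz_fbasis_bounds[OF W] by blast
  have W_eq: "W j = closure (span ((\<lambda>i. e i j) ` I j))" if "j \<in> J" for j
    using e[OF that] by (simp add: orthonormal_basis_def)
  have bounds: "(norm (\<Sum>a\<in>F. scale (c a) (?f a)))\<^sup>2 \<le> K\<^sup>2 * (\<Sum>a\<in>F. (norm (c a))\<^sup>2)"
      "(\<Sum>a\<in>F. (norm (c a))\<^sup>2) \<le> K\<^sup>2 * (norm (\<Sum>a\<in>F. scale (c a) (?f a)))\<^sup>2"
    if F: "finite F" "F \<subseteq> ?A" for F c
  proof -
    \<comment> \<open>Grouping the combination by blocks: \<open>w j\<close> collects the terms with
      first index \<open>j\<close>. It lies in \<open>W j\<close>, and orthonormality within the
      block makes its squared norm the sum of the squared coefficients there.\<close>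
    define w where "w j = (\<Sum>a\<in>{a\<in>F. fst a = j}. scale (c a) (?f a))" for j
    have fst_F: "finite (fst ` F)" "fst ` F \<subseteq> J"
      using F by auto
    have sum_w: "(\<Sum>a\<in>F. scale (c a) (?f a)) = sum w (fst ` F)"
      unfolding w_def by (rule sum.image_gen[OF F(1)])
    have w_in: "w j \<in> W j" if "j \<in> fst ` F" for j
    proof -
      have "w j \<in> span ((\<lambda>i. e i j) ` I j)"
        unfolding w_def using F(2) by (intro span_sum span_scale span_base) auto
      then show ?thesis
        using W_eq[of j] that fst_F closure_subset by blast
    qed
    have "(norm (w j))\<^sup>2 = (\<Sum>a\<in>{a\<in>F. fst a = j}. (norm (c a))\<^sup>2)" if "j \<in> fst ` F" for j
    proof -
      have "j \<in> J" using that fst_F by blast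
      then have orth: "ip (e i j) (e k j) = (if i = k then 1 else 0)" if "i \<in> I j" "k \<in> I j" for i k
        using e that unfolding orthonormal_basis_def by blast
      have "ip (?f a) (?f b) = (if a = b then 1 else 0)"
        if "a \<in> {a\<in>F. fst a = j}" "b \<in> {a\<in>F. fst a = j}" for a b
        using that subsetD[OF F(2), of a] subsetD[OF F(2), of b] by (auto simp: orth split: if_splits)
      then show ?thesis
        unfolding w_def using F(1) by (intro norm_sum_orthonormal) auto
    qed
    then have norm_w: "(\<Sum>a\<in>F. (norm (c a))\<^sup>2) = (\<Sum>j\<in>fst ` F. (norm (w j))\<^sup>2)"
      using sum.image_gen[OF F(1), of "\<lambda>a. (norm (c a))\<^sup>2" fst] by simp
    show "(norm (\<Sum>a\<in>F. scale (c a) (?f a)))\<^sup>2 \<le> K\<^sup>2 * (\<Sum>a\<in>F. (norm (c a))\<^sup>2)"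
      unfolding sum_w norm_w using K(2) fst_F w_in by blast
    show "(\<Sum>a\<in>F. (norm (c a))\<^sup>2) \<le> K\<^sup>2 * (norm (\<Sum>a\<in>F. scale (c a) (?f a)))\<^sup>2"
      unfolding sum_w norm_w using K(2) fst_F w_in by blast
  qed
  have "W j \<subseteq> closure (span (?f ` ?A))" if "j \<in> J" for j
    unfolding W_eq[OF that] using that by (intro closure_mono span_mono) force
  then have "closure (span (\<Union>j\<in>J. W j)) \<subseteq> closure (span (?f ` ?A))"
    by (intro closure_span_minimal) blast
  then have "closure (span (?f ` ?A)) = UNIV"
    using riesz_fbasis_dense[OF W] by blast
  moreover have "countable ?A"
    using assms(1,2) by blast
  ultimately show ?thesis
    using bounds K(1) by (intro riesz_basisI[where K = K and L = K])
qed

section \<open>From a Riesz basis to a Riesz f-basis\<close>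

lemma riesz_basis_imp_riesz_fbasis:
  assumes e: "\<And>j. j \<in> J \<Longrightarrow> orthonormal_basis (I j) (\<lambda>i. e i j) (W j)"
    and "riesz_basis (SIGMA j:J. I j) (\<lambda>(j, i). e i j)"
  shows "riesz_fbasis J W"
proof -
  obtain u T S where u: "orthonormal_basis (SIGMA j:J. I j) u UNIV"
    and Tu: "\<And>j i. j \<in> J \<Longrightarrow> i \<in> I j \<Longrightarrow> T (u (j, i)) = e i j"
    and T: "bounded_operator T" and S: "bounded_operator S" and inv: "S \<circ> T = id" "T \<circ> S = id"
    using assms(2) unfolding riesz_basis_def bounded_invertible_operator_def by fastforce
  have ST: "S (T x) = x" and TS: "T (S x) = x" for x
    using inv[THEN fun_cong, of x] by simp_all
  define V where "V j = closure (span (u ` ({j} \<times> I j)))" for j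
  have V_closed: "closed_subspace (V j)" for j
    unfolding V_def by (rule closed_subspace_closure_span)
  have orth: "ip x y = 0" if ij: "i \<in> J" "j \<in> J" "i \<noteq> j" and xy: "x \<in> V i" "y \<in> V j" for i j x y
  proof (rule orthogonal_closure_span[OF _ xy(1)[unfolded V_def]])
    fix a assume "a \<in> u ` ({i} \<times> I i)"
    then have "ip b a = 0" if "b \<in> u ` ({j} \<times> I j)" for b
      using u that ij by (auto simp: orthonormal_basis_def)
    then have "ip y a = 0"
      using orthogonal_closure_span xy(2) unfolding V_def by blast
    then show "ip a y = 0"
      by (simp add: ip_zero_commute)
  qed
  \<comment> \<open>For \<open>i = j\<close> the residual is 0; otherwise \<open>g\<close> is
    orthogonal to \<open>V i\<close>, so 0 satisfies the description of the projection.\<close>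
  have "proj (V i) g = (if i = j then g else 0)" if "i \<in> J" "j \<in> J" "g \<in> V j" for i j g
    using that orth[of j i g] V_closed[of i]
    by (intro proj_eqI) (auto simp: closed_subspace_def subspace_0)
  moreover have "closure (span (\<Union>j\<in>J. V j)) = UNIV"
  proof -
    have "u ` (SIGMA j:J. I j) \<subseteq> (\<Union>j\<in>J. V j)"
      unfolding V_def by (force intro: closure_subset[THEN subsetD] span_base)
    then have "closure (span (u ` (SIGMA j:J. I j))) \<subseteq> closure (span (\<Union>j\<in>J. V j))"
      by (intro closure_mono span_mono)
    then show ?thesis
      using u by (auto simp: orthonormal_basis_def)
  qed
  ultimately have "orthonormal_fbasis J V"
    using V_closed by (simp add: orthonormal_fbasis_def)
  moreover have "T ` V j = W j" if "j \<in> J" for j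
  proof
    have W: "W j = closure (span ((\<lambda>i. e i j) ` I j))"
      using e[OF that] by (simp add: orthonormal_basis_def)
    have Te: "T ` u ` ({j} \<times> I j) = (\<lambda>i. e i j) ` I j"
      using Tu[OF that] by force
    show "T ` V j \<subseteq> W j"
      unfolding V_def W Te[symmetric] by (rule bounded_operator_image_closure_span[OF T])
    \<comment> \<open>For the reverse inclusion the inverse sends the block of \<open>e\<close> back
      to the block of \<open>u\<close>, hence \<open>W j\<close> into \<open>V j\<close>; applying
      \<open>T\<close> recovers each point of \<open>W j\<close>.\<close>
    have "S ` (\<lambda>i. e i j) ` I j = u ` ({j} \<times> I j)"
      unfolding Te[symmetric] by (simp add: image_image ST)
    then have "S ` W j \<subseteq> V j"
      unfolding V_def W using bounded_operator_image_closure_span[OF S] by metis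
    then show "W j \<subseteq> T ` V j"
      using TS by (metis image_eqI image_subset_iff subsetI)
  qed
  ultimately show ?thesis
    unfolding riesz_fbasis_def bounded_invertible_operator_def using T S inv by blast
qed

end

theorem corollary3p16:
  fixes scale :: "'k::rc_field \<Rightarrow> 'a::banach \<Rightarrow> 'a"
    and ip :: "'a \<Rightarrow> 'a \<Rightarrow> 'k"
    and J :: "'j set" and I :: "'j \<Rightarrow> 'i set"
    and W :: "'j \<Rightarrow> 'a set" and e :: "'i \<Rightarrow> 'j \<Rightarrow> 'a"
  assumes "separable_hilbert_space scale ip"
    and "countable J" and "\<And>j. j \<in> J \<Longrightarrow> countable (I j)"
    and "\<And>j. j \<in> J \<Longrightarrow> hilbert_space.closed_subspace scale (W j)"
    and "\<And>j. j \<in> J \<Longrightarrow> hilbert_space.orthonormal_basis scale ip (I j) (\<lambda>i. e i j) (W j)"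
  shows "hilbert_space.riesz_fbasis scale ip J W \<longleftrightarrow>
         hilbert_space.riesz_basis scale ip (SIGMA j:J. I j) (\<lambda>(j, i). e i j)"
proof -
  interpret separable_hilbert_space scale ip
    by (rule assms(1))
  show ?thesis
    by (rule iffI[OF riesz_fbasis_imp_riesz_basis[OF assms(2,3,5)]
          riesz_basis_imp_riesz_fbasis[OF assms(5)]])
qed

end
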